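(* Suppose the entries of $\boldsymbol{\hat\phi}$ are i.i.d. with mean $\phi$ and variance $\frac{1}{N_e^2 r}$, and that $\mathbf{H}=\mathbb{I}$, so that the mean squared error is $\epsilon(\mathbf{g}) = \mathbb{E}\big[(\mathbf{g}^T(\boldsymbol{\hat\phi}+\mathbf{n})-\phi)^2\big]$. Then the minimum error of the estimator is $$\min_{\mathbf{g}\in\mathbb{R}^K}\epsilon(\mathbf{g}) = \phi^2\left(\frac{\frac{1}{N_e^2 r}+v}{\frac{1}{N_e^2 r}+K\phi^2+v}\right).$$
   Context: Let $K,N_e,r\ge 1$ be integers, $\phi\in\mathbb{R}$ a fixed parameter and $v\ge 0$. The random vector $\boldsymbol{\hat\phi}=(\hat\phi_1,\dots,\hat\phi_K)^T$ collects the estimates of $\phi$ from $K$ clusters; each estimate is unbiased, $\mathbb{E}[\hat\phi_i]=\phi$, with variance $\frac{1}{N_e^2 r}$. The noise $\mathbf{n}=(n_1,\dots,n_K)^T$ has independent zero-mean Gaussian entries of variance $v$ and is independent of $\boldsymbol{\hat\phi}$ (noise is absent when $v=0$). In general the final estimate is $\mathbf{g}^T(\mathbf{H}\boldsymbol{\hat\phi}+\mathbf{n})$ with channel matrix $\mathbf{H}\in\mathbb{R}^{K\times K}$ and deterministic combiner $\mathbf{g}\in\mathbb{R}^K$; $\mathbb{I}$ is the identity matrix. *)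

theory Defs
  imports "HOL-Probability.Probability"
begin

(* The library's "distributed" with a density covers only positive variance;
   variance 0 is the point mass at the mean. *)
definition gaussian_rv :: "'a measure \<Rightarrow> ('a \<Rightarrow> real) \<Rightarrow> real \<Rightarrow> real \<Rightarrow> bool" where
  "gaussian_rv M X m v \<longleftrightarrow>
     X \<in> borel_measurable M \<and>
     (if v = 0 then AE \<omega> in M. X \<omega> = m
      else distributed M lborel X (normal_density m (sqrt v)))"

definition identically_distributed :: "'a measure \<Rightarrow> ('i \<Rightarrow> 'a \<Rightarrow> real) \<Rightarrow> bool" where
  "identically_distributed M X \<longleftrightarrow> (\<forall>i j. distr M borel (X i) = distr M borel (X j))"

definition mse ::
  "'a measure \<Rightarrow> real ^ 'k ^ 'k \<Rightarrow> ('a \<Rightarrow> real ^ 'k) \<Rightarrow> ('a \<Rightarrow> real ^ 'k) \<Rightarrow> real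
    \<Rightarrow> real ^ 'k \<Rightarrow> real" where
  "mse M H phihat noise \<phi> g =
     (LINT \<omega>|M. (g \<bullet> (H *v phihat \<omega> + noise \<omega>) - \<phi>)\<^sup>2)"

end

theory Submission
  imports Defs
begin

(* Write the error as g \<bullet> Z + \<phi> (G - 1) with Z = phihat + noise - (\<phi>,...,\<phi>), whose entries are
   centred and uncorrelated, and G the sum of the entries of g. With c their common variance, the
   mean squared error is c |g|^2 + \<phi>^2 (G - 1)^2. Completing the square around the constant vector
   with entries t = \<phi>^2 / (c + K \<phi>^2) shows that it exceeds the claimed minimum by
   c |g - (t,...,t)|^2 + \<phi>^2 (G - K t)^2. *)

text \<open>The product is dominated by the sum of the two squares. This gives integrability of
  every mixed term that appears when a square is expanded.\<close>

lemma integrable_mult_of_squares: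
  fixes X Y :: "'a \<Rightarrow> real"
  assumes [measurable]: "X \<in> borel_measurable M" "Y \<in> borel_measurable M"
    and "integrable M (\<lambda>x. (X x)\<^sup>2)" "integrable M (\<lambda>x. (Y x)\<^sup>2)"
  shows "integrable M (\<lambda>x. X x * Y x)"
proof (rule Bochner_Integration.integrable_bound)
  show "integrable M (\<lambda>x. (X x)\<^sup>2 + (Y x)\<^sup>2)"
    using assms by simp
  have "\<bar>a * b\<bar> \<le> a\<^sup>2 + b\<^sup>2" for a b :: real
    using sum_squares_bound[of "\<bar>a\<bar>" "\<bar>b\<bar>"] abs_ge_zero[of "a * b"]
    unfolding abs_mult power2_abs by linarith
  then show "AE x in M. norm (X x * Y x) \<le> norm ((X x)\<^sup>2 + (Y x)\<^sup>2)"
    by simp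
qed simp

context prob_space
begin

text \<open>Restricting the family to the pair \<open>{i, j}\<close> turns the product rule for
  finite families into the rule for two factors; \<open>i \<noteq> j\<close> makes the product over
  that set have two factors.\<close>

lemma indep_vars_expectation_mult:
  fixes X :: "'i \<Rightarrow> 'a \<Rightarrow> real"
  assumes "indep_vars (\<lambda>_. borel) X I" "i \<in> I" "j \<in> I" "i \<noteq> j"
    and "integrable M (X i)" "integrable M (X j)"
  shows "expectation (\<lambda>x. X i x * X j x) = expectation (X i) * expectation (X j)"
proof -
  have "indep_vars (\<lambda>_. borel) X {i, j}"
    using assms by (intro indep_vars_subset[OF assms(1)]) auto
  then have "expectation (\<lambda>x. \<Prod>k\<in>{i, j}. X k x) = (\<Prod>k\<in>{i, j}. expectation (X k))"
    using assms by (intro indep_vars_lebesgue_integral) auto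
  then show ?thesis
    using \<open>i \<noteq> j\<close> by simp
qed

text \<open>Expanding the square gives a double sum, a term linear in the \<open>Z i\<close>, and
  \<open>a\<close> squared. The linear term vanishes by \<open>mean\<close>, and \<open>cov\<close>
  leaves only the diagonal of the double sum.\<close>

lemma expectation_square_uncorrelated_sum:
  fixes Z :: "'i \<Rightarrow> 'a \<Rightarrow> real"
  assumes "finite I"
    and meas: "\<And>i. i \<in> I \<Longrightarrow> Z i \<in> borel_measurable M"
    and sq: "\<And>i. i \<in> I \<Longrightarrow> integrable M (\<lambda>x. (Z i x)\<^sup>2)"
    and mean: "\<And>i. i \<in> I \<Longrightarrow> expectation (Z i) = 0"
    and cov: "\<And>i j. i \<in> I \<Longrightarrow> j \<in> I \<Longrightarrow>
      expectation (\<lambda>x. Z i x * Z j x) = (if i = j then c else 0)"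
  shows "expectation (\<lambda>x. ((\<Sum>i\<in>I. g i * Z i x) + a)\<^sup>2) = c * (\<Sum>i\<in>I. (g i)\<^sup>2) + a\<^sup>2"
proof -
  have int: "integrable M (Z i)" if "i \<in> I" for i
    using meas sq that by (blast intro: square_integrable_imp_integrable)
  have int2: "integrable M (\<lambda>x. Z i x * Z j x)" if "i \<in> I" "j \<in> I" for i j
    using meas sq that by (blast intro: integrable_mult_of_squares)
  have "((\<Sum>i\<in>I. g i * Z i x) + a)\<^sup>2
      = (\<Sum>i\<in>I. \<Sum>j\<in>I. (g i * g j) * (Z i x * Z j x)) + (\<Sum>i\<in>I. (2 * a * g i) * Z i x) + a\<^sup>2" for x
  proof -
    have "(\<Sum>i\<in>I. g i * Z i x)\<^sup>2 = (\<Sum>i\<in>I. \<Sum>j\<in>I. (g i * g j) * (Z i x * Z j x))"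
      unfolding power2_eq_square sum_product by (intro sum.cong refl) (simp add: mult_ac)
    moreover have "2 * (\<Sum>i\<in>I. g i * Z i x) * a = (\<Sum>i\<in>I. (2 * a * g i) * Z i x)"
      unfolding sum_distrib_left sum_distrib_right by (intro sum.cong refl) (simp add: mult_ac)
    ultimately show ?thesis
      unfolding power2_sum by simp
  qed
  then have "expectation (\<lambda>x. ((\<Sum>i\<in>I. g i * Z i x) + a)\<^sup>2) = expectation (\<lambda>x.
      (\<Sum>i\<in>I. \<Sum>j\<in>I. (g i * g j) * (Z i x * Z j x)) + (\<Sum>i\<in>I. (2 * a * g i) * Z i x) + a\<^sup>2)"
    by simp
  also have "\<dots> = (\<Sum>i\<in>I. \<Sum>j\<in>I. (g i * g j) * expectation (\<lambda>x. Z i x * Z j x))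
      + (\<Sum>i\<in>I. (2 * a * g i) * expectation (Z i)) + a\<^sup>2"
    using int int2 by (simp add: prob_space)
  also have "\<dots> = (\<Sum>i\<in>I. \<Sum>j\<in>I. if i = j then c * (g i)\<^sup>2 else 0) + a\<^sup>2"
  proof -
    have "(g i * g j) * expectation (\<lambda>x. Z i x * Z j x) = (if i = j then c * (g i)\<^sup>2 else 0)"
      if "i \<in> I" "j \<in> I" for i j
      using cov[OF that] by (simp add: power2_eq_square)
    then show ?thesis
      using mean by simp
  qed
  also have "\<dots> = c * (\<Sum>i\<in>I. (g i)\<^sup>2) + a\<^sup>2"
    using \<open>finite I\<close> by (simp add: sum_distrib_left)
  finally show ?thesis .
qed

text \<open>The noise enters the error only through these moments. For \<open>v = 0\<close> they
  come from almost sure equality with the constant \<open>m\<close>, otherwise from the normal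
  density.\<close>

lemma gaussian_rv_moments:
  assumes "gaussian_rv M X m v" "v \<ge> 0"
  shows "X \<in> borel_measurable M" "integrable M (\<lambda>x. (X x - m)\<^sup>2)"
    "expectation X = m" "expectation (\<lambda>x. (X x - m)\<^sup>2) = v"
proof -
  show [measurable]: "X \<in> borel_measurable M"
    using assms by (simp add: gaussian_rv_def)
  have "integrable M (\<lambda>x. (X x - m)\<^sup>2) \<and> expectation X = m \<and> expectation (\<lambda>x. (X x - m)\<^sup>2) = v"
  proof (cases "v = 0")
    case True
    then have ae: "AE x in M. X x = m"
      using assms by (simp add: gaussian_rv_def)
    then have "integrable M (\<lambda>x. (X x - m)\<^sup>2) \<longleftrightarrow> integrable M (\<lambda>x. 0 :: real)"
      by (intro integrable_cong_AE) auto
    moreover have "expectation X = expectation (\<lambda>x. m)"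
      using ae by (intro integral_cong_AE) auto
    moreover have "expectation (\<lambda>x. (X x - m)\<^sup>2) = expectation (\<lambda>x. 0)"
      using ae by (intro integral_cong_AE) auto
    ultimately show ?thesis
      using True by (simp add: prob_space)
  next
    case False
    then have pos: "0 < sqrt v" and D: "distributed M lborel X (normal_density m (sqrt v))"
      using assms by (simp_all add: gaussian_rv_def)
    \<comment> \<open>Integrability is transferred to the density side, where it is the existence of
      the second central moment.\<close>
    have "integrable M (\<lambda>x. (X x - m)\<^sup>2)"
      using distributed_integrable[OF D, of "\<lambda>x. (x - m)\<^sup>2"] integrable_normal_moment[OF pos, of m 2]
      by simp
    then show ?thesis
      using normal_distributed_expectation[OF pos D] normal_distributed_variance[OF pos D] assms(2)
      by simp
  qed
  then show "integrable M (\<lambda>x. (X x - m)\<^sup>2)" "expectation X = m" "expectation (\<lambda>x. (X x - m)\<^sup>2) = v"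
    by auto
qed

text \<open>Variances add: of the four products, the two within a family contribute \<open>s\<close>
  and \<open>v\<close> on the diagonal, while the mixed ones factor into means that are 0.\<close>

lemma expectation_mult_indep_sum:
  fixes A B :: "'i \<Rightarrow> 'a \<Rightarrow> real"
  assumes indA: "indep_vars (\<lambda>_. borel) A I" and indB: "indep_vars (\<lambda>_. borel) B I"
    and indAB: "\<And>i j. i \<in> I \<Longrightarrow> j \<in> I \<Longrightarrow> indep_var borel (A i) borel (B j)"
    and sqA: "\<And>i. i \<in> I \<Longrightarrow> integrable M (\<lambda>x. (A i x)\<^sup>2)"
    and sqB: "\<And>i. i \<in> I \<Longrightarrow> integrable M (\<lambda>x. (B i x)\<^sup>2)"
    and meanA: "\<And>i. i \<in> I \<Longrightarrow> expectation (A i) = 0"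
    and meanB: "\<And>i. i \<in> I \<Longrightarrow> expectation (B i) = 0"
    and varA: "\<And>i. i \<in> I \<Longrightarrow> expectation (\<lambda>x. (A i x)\<^sup>2) = s"
    and varB: "\<And>i. i \<in> I \<Longrightarrow> expectation (\<lambda>x. (B i x)\<^sup>2) = v"
    and ij: "i \<in> I" "j \<in> I"
  shows "expectation (\<lambda>x. (A i x + B i x) * (A j x + B j x)) = (if i = j then s + v else 0)"
proof -
  have meas: "A k \<in> borel_measurable M" "B k \<in> borel_measurable M" if "k \<in> I" for k
    using indA indB that by (auto simp: indep_vars_def)
  have int: "integrable M (A k)" "integrable M (B k)" if "k \<in> I" for k
    using meas sqA sqB that by (blast intro: square_integrable_imp_integrable)+
  \<comment> \<open>Letting \<open>X\<close> and \<open>Y\<close> range over both families covers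
    all four kinds of product at once.\<close>
  have prod: "integrable M (\<lambda>x. X k x * Y l x)"
    if "X \<in> {A, B}" "Y \<in> {A, B}" "k \<in> I" "l \<in> I" for X Y k l
    using that meas sqA sqB by (intro integrable_mult_of_squares) auto
  have cross: "expectation (\<lambda>x. A k x * B l x) = 0" if "k \<in> I" "l \<in> I" for k l
    using indep_var_lebesgue_integral[OF indAB[OF that] int(1)[OF that(1)] int(2)[OF that(2)]]
      meanA[OF that(1)] by simp
  have AA: "expectation (\<lambda>x. A i x * A j x) = (if i = j then s else 0)"
    using ij indep_vars_expectation_mult[OF indA ij _ int(1) int(1)] varA[OF ij(1)] meanA
    by (auto simp: power2_eq_square)
  have BB: "expectation (\<lambda>x. B i x * B j x) = (if i = j then v else 0)"
    using ij indep_vars_expectation_mult[OF indB ij _ int(2) int(2)] varB[OF ij(1)] meanB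
    by (auto simp: power2_eq_square)
  \<comment> \<open>Both mixed terms are written with the \<open>A\<close> factor first, the shape
    in which \<open>cross\<close> applies.\<close>
  have "expectation (\<lambda>x. (A i x + B i x) * (A j x + B j x)) = expectation (\<lambda>x.
      (A i x * A j x + B i x * B j x) + (A i x * B j x + A j x * B i x))"
    by (intro Bochner_Integration.integral_cong) (simp_all add: algebra_simps)
  also have "\<dots> = (if i = j then s + v else 0)"
    using ij prod by (simp add: AA BB cross)
  finally show ?thesis .
qed

end

text \<open>Completing the square, with \<open>t\<close> the stationary point of the left side along
  constant vectors. For infinite \<open>I\<close> the sums and \<open>card I\<close> are all 0 and
  both sides equal \<open>p\<^sup>2\<close>.\<close>

lemma penalized_square_eq:
  fixes g :: "'i \<Rightarrow> real" and I :: "'i set" and c p :: real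
  assumes "c > 0"
  defines "t \<equiv> p\<^sup>2 / (c + real (card I) * p\<^sup>2)"
  shows "c * (\<Sum>i\<in>I. (g i)\<^sup>2) + (p * ((\<Sum>i\<in>I. g i) - 1))\<^sup>2
    = p\<^sup>2 * (c / (c + real (card I) * p\<^sup>2))
      + c * (\<Sum>i\<in>I. (g i - t)\<^sup>2) + p\<^sup>2 * ((\<Sum>i\<in>I. g i) - real (card I) * t)\<^sup>2"
proof -
  define G S K where "G = (\<Sum>i\<in>I. g i)" and "S = (\<Sum>i\<in>I. (g i)\<^sup>2)" and "K = real (card I)"
  have pos: "0 < c + K * p\<^sup>2"
    using \<open>c > 0\<close> by (simp add: K_def add_pos_nonneg)
  have t_eq: "t = p\<^sup>2 / (c + K * p\<^sup>2)"
    by (simp add: t_def K_def)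
  \<comment> \<open>This is the stationarity condition
    \<open>c * t = p\<^sup>2 * (1 - K * t)\<close>, free of division so that \<open>algebra\<close>
    can use it.\<close>
  have t: "t * (c + K * p\<^sup>2) = p\<^sup>2"
    using pos by (simp add: t_eq)
  then have "p\<^sup>2 * c = (p\<^sup>2 - K * p\<^sup>2 * t) * (c + K * p\<^sup>2)"
    by algebra
  \<comment> \<open>The minimum value as a polynomial in \<open>t\<close>, which removes the last
    quotient from the identity.\<close>
  then have m: "p\<^sup>2 * (c / (c + K * p\<^sup>2)) = p\<^sup>2 - K * p\<^sup>2 * t"
    using pos by (simp add: divide_eq_eq)
  have "(\<Sum>i\<in>I. (g i - t)\<^sup>2) = (\<Sum>i\<in>I. (g i)\<^sup>2 - 2 * t * g i + t\<^sup>2)"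
    by (intro sum.cong refl) (simp add: power2_diff)
  also have "\<dots> = (\<Sum>i\<in>I. (g i)\<^sup>2) - (\<Sum>i\<in>I. 2 * t * g i) + K * t\<^sup>2"
    by (simp add: K_def sum.distrib sum_subtractf)
  also have "\<dots> = S - 2 * t * G + K * t\<^sup>2"
    by (simp only: S_def G_def sum_distrib_left)
  finally have q: "(\<Sum>i\<in>I. (g i - t)\<^sup>2) = S - 2 * t * G + K * t\<^sup>2" .
  \<comment> \<open>The terms in \<open>S\<close> and in the square of \<open>G\<close> agree
    outright; those linear in \<open>G\<close> and the constant ones agree by
    \<open>t\<close>.\<close>
  have "c * S + (p * (G - 1))\<^sup>2
      = (p\<^sup>2 - K * p\<^sup>2 * t) + c * (S - 2 * t * G + K * t\<^sup>2) + p\<^sup>2 * (G - K * t)\<^sup>2"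
    using t by algebra
  then show ?thesis
    by (simp only: m q G_def [symmetric] S_def [symmetric] K_def [symmetric])
qed

theorem lemma4:
  fixes M :: "'a measure"
    and phihat noise :: "'a \<Rightarrow> real ^ 'k"
    and H :: "real ^ 'k ^ 'k"
    and N\<^sub>e r :: nat
    and \<phi> v :: real
  assumes "prob_space M"
    and "N\<^sub>e \<ge> 1" and "r \<ge> 1" and "v \<ge> 0"
    and "prob_space.indep_vars M (\<lambda>_. borel) (\<lambda>i \<omega>. phihat \<omega> $ i) UNIV"
    and "identically_distributed M (\<lambda>i \<omega>. phihat \<omega> $ i)"
    and "\<And>i. integrable M (\<lambda>\<omega>. phihat \<omega> $ i)"
    and "\<And>i. integrable M (\<lambda>\<omega>. (phihat \<omega> $ i)\<^sup>2)"
    and "\<And>i. prob_space.expectation M (\<lambda>\<omega>. phihat \<omega> $ i) = \<phi>"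
    and "\<And>i. prob_space.variance M (\<lambda>\<omega>. phihat \<omega> $ i) = 1 / ((real N\<^sub>e)\<^sup>2 * real r)"
    and "prob_space.indep_vars M (\<lambda>_. borel) (\<lambda>i \<omega>. noise \<omega> $ i) UNIV"
    and "\<And>i. gaussian_rv M (\<lambda>\<omega>. noise \<omega> $ i) 0 v"
    and "prob_space.indep_var M borel phihat borel noise"
    and "H = mat 1"
  defines "\<epsilon>\<^sub>m\<^sub>i\<^sub>n \<equiv> \<phi>\<^sup>2 * ((1 / ((real N\<^sub>e)\<^sup>2 * real r) + v)
      / (1 / ((real N\<^sub>e)\<^sup>2 * real r) + real CARD('k) * \<phi>\<^sup>2 + v))"
  shows "(\<exists>g. mse M H phihat noise \<phi> g = \<epsilon>\<^sub>m\<^sub>i\<^sub>n)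
    \<and> (\<forall>g. \<epsilon>\<^sub>m\<^sub>i\<^sub>n \<le> mse M H phihat noise \<phi> g)"
proof -
  interpret prob_space M by fact
  define s c where "s = 1 / ((real N\<^sub>e)\<^sup>2 * real r)" and "c = s + v"
  \<comment> \<open>Positivity of \<open>s\<close> keeps \<open>c\<close> positive even without
    noise, so the denominator of \<open>t\<close> is nonzero also when
    \<open>\<phi> = 0\<close>.\<close>
  have "s > 0"
    using assms(2,3) by (simp add: s_def)
  then have "c > 0"
    using \<open>v \<ge> 0\<close> by (simp add: c_def)
  define A where "A i \<omega> = phihat \<omega> $ i - \<phi>" for i \<omega>
  define B where "B i \<omega> = noise \<omega> $ i" for i \<omega>
  define t where "t = \<phi>\<^sup>2 / (c + real CARD('k) * \<phi>\<^sup>2)"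
  have gauss: "B i \<in> borel_measurable M" "integrable M (\<lambda>\<omega>. (B i \<omega>)\<^sup>2)" "expectation (B i) = 0"
    "expectation (\<lambda>\<omega>. (B i \<omega>)\<^sup>2) = v" for i
    using gaussian_rv_moments[OF assms(12) \<open>v \<ge> 0\<close>, of i] by (simp_all add: B_def [abs_def])
  have indA: "indep_vars (\<lambda>_. borel) A UNIV"
    unfolding A_def [abs_def]
    by (rule indep_vars_compose2[OF assms(5), where Y = "\<lambda>_ x. x - \<phi>"]) simp
  have indB: "indep_vars (\<lambda>_. borel) B UNIV"
    unfolding B_def [abs_def] by fact
  have indAB: "indep_var borel (A i) borel (B j)" for i j
    using indep_var_compose[OF assms(13), of "\<lambda>x. x $ i - \<phi>" borel "\<lambda>x. x $ j" borel]
    by (simp add: comp_def A_def [abs_def] B_def [abs_def])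
  have A_meas: "A i \<in> borel_measurable M" for i
    using assms(7)[of i] by (simp add: A_def [abs_def])
  have sqA: "integrable M (\<lambda>\<omega>. (A i \<omega>)\<^sup>2)" for i
    using assms(7,8)[of i] by (simp add: A_def power2_diff)
  have meanA: "expectation (A i) = 0" for i
    using assms(7,9)[of i] by (simp add: A_def [abs_def] prob_space)
  \<comment> \<open>The library variance is centred at the expectation, which the mean assumption
    identifies with \<open>\<phi>\<close>.\<close>
  have varA: "expectation (\<lambda>\<omega>. (A i \<omega>)\<^sup>2) = s" for i
    using assms(9,10)[of i] by (simp add: A_def s_def)
  have intA: "integrable M (A i)" and intB: "integrable M (B i)" for i
    using A_meas sqA gauss(1,2) by (blast intro: square_integrable_imp_integrable)+
  have sqZ: "integrable M (\<lambda>\<omega>. (A i \<omega> + B i \<omega>)\<^sup>2)" for i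
    using sqA gauss(2) integrable_mult_of_squares[OF A_meas gauss(1) sqA gauss(2), of i i]
    by (simp add: power2_sum mult.assoc)
  have cov: "expectation (\<lambda>\<omega>. (A i \<omega> + B i \<omega>) * (A j \<omega> + B j \<omega>)) = (if i = j then c else 0)"
    for i j
    unfolding c_def
    by (rule expectation_mult_indep_sum[OF indA indB indAB]) (simp_all add: sqA meanA varA gauss)
  have "mse M H phihat noise \<phi> g
      = c * (\<Sum>i\<in>UNIV. (g $ i)\<^sup>2) + (\<phi> * ((\<Sum>i\<in>UNIV. g $ i) - 1))\<^sup>2" for g
  proof -
    \<comment> \<open>Centring each estimate splits off \<open>\<phi>\<close> times the sum of the
      entries of \<open>g\<close>; together with \<open>- \<phi>\<close> this is the deterministic
      bias.\<close>
    have "g \<bullet> (H *v phihat \<omega> + noise \<omega>) - \<phi>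
        = (\<Sum>i\<in>UNIV. g $ i * (A i \<omega> + B i \<omega>)) + \<phi> * ((\<Sum>i\<in>UNIV. g $ i) - 1)" for \<omega>
      by (simp add: \<open>H = mat 1\<close> inner_vec_def A_def B_def algebra_simps sum.distrib sum_subtractf
          sum_distrib_left)
    then show ?thesis
      unfolding mse_def
      using expectation_square_uncorrelated_sum[of UNIV "\<lambda>i \<omega>. A i \<omega> + B i \<omega>" c "\<lambda>i. g $ i"]
        A_meas gauss(1,3) sqZ cov intA intB meanA by simp
  qed
  then have mse: "mse M H phihat noise \<phi> g = \<epsilon>\<^sub>m\<^sub>i\<^sub>n + c * (\<Sum>i\<in>UNIV. (g $ i - t)\<^sup>2)
      + \<phi>\<^sup>2 * ((\<Sum>i\<in>UNIV. g $ i) - real CARD('k) * t)\<^sup>2" for g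
    using penalized_square_eq[OF \<open>c > 0\<close>, where g = "\<lambda>i. g $ i" and I = UNIV and p = \<phi>]
    by (simp add: \<epsilon>\<^sub>m\<^sub>i\<^sub>n_def t_def c_def s_def add_ac)
  \<comment> \<open>Both excess terms vanish here, since the entries of this vector equal
    \<open>t\<close> and sum to \<open>real CARD('k) * t\<close>.\<close>
  have "mse M H phihat noise \<phi> (\<chi> i. t) = \<epsilon>\<^sub>m\<^sub>i\<^sub>n"
    by (simp add: mse)
  moreover have "\<epsilon>\<^sub>m\<^sub>i\<^sub>n \<le> mse M H phihat noise \<phi> g" for g
    using \<open>c > 0\<close> by (simp add: mse sum_nonneg)
  ultimately show ?thesis
    by blast
qed

end
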